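(* Let $(\hat{\mathfrak{g}},[\,,\,]_\wedge,\hat N)$ be an abelian extension of a Nijenhuis Leibniz algebra $(\mathfrak{g},[\,,\,],N)$ by $(V,\mu,N_V)$. For a section $s:\mathfrak{g}\to\hat{\mathfrak{g}}$ define $\psi:\mathfrak{g}\otimes\mathfrak{g}\to V$ and $\chi:\mathfrak{g}\to V$ by $$\psi(x\otimes y)=[s(x),s(y)]_\wedge-s([x,y]),\qquad \chi(x)=\hat N(s(x))-s(N(x))$$ for all $x,y\in\mathfrak{g}$. Then the cohomology class of $(\psi,\chi)$ in $H^2_{NLA}(\mathfrak{g},V)$ is independent of the choice of section; i.e. if $(\psi_1,\chi_1)$ and $(\psi_2,\chi_2)$ are obtained from two sections $s_1,s_2$, then $(\psi_1,\chi_1)-(\psi_2,\chi_2)$ lies in the image of $d^1:C^1_{NLA}(\mathfrak{g},V)\to C^2_{NLA}(\mathfrak{g},V)$.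
   Context: All vector spaces are over a field $\mathbb{K}$ of characteristic $0$. A (left) Leibniz algebra is a vector space with a bilinear bracket satisfying $[x,[y,z]]=[[x,y],z]+[y,[x,z]]$. A Nijenhuis operator is a linear map $N$ with $[Nx,Ny]=N([Nx,y]+[x,Ny]-N[x,y])$; a Nijenhuis Leibniz algebra is a Leibniz algebra with a Nijenhuis operator; morphisms are Leibniz algebra morphisms commuting with the Nijenhuis operators. Let $V$ be a vector space with a linear operator $N_V$ and trivial bracket $\mu=0$; then $(V,\mu,N_V)$ is a Nijenhuis Leibniz algebra. An abelian extension of $(\mathfrak{g},[\,,\,],N)$ by $(V,\mu,N_V)$ is a Nijenhuis Leibniz algebra $(\hat{\mathfrak{g}},[\,,\,]_\wedge,\hat N)$ with a short exact sequence of morphisms of Nijenhuis Leibniz algebras $0\to V\xrightarrow{i}\hat{\mathfrak{g}}\xrightarrow{p}\mathfrak{g}\to0$. One identifies $V$ with $i(V)\subseteq\hat{\mathfrak{g}}$. A section is a linear map $s:\mathfrak{g}\to\hat{\mathfrak{g}}$ with $p\circ s=\mathrm{Id}_{\mathfrak{g}}$. $V$ carries the induced representation $\bar l_V(x,u)=[s(x),u]_\wedge$, $\bar r_V(u,x)=[u,s(x)]_\wedge$, together with $N_V$; it does not depend on the section $s$. Cochains: $C^1_{NLA}(\mathfrak{g},V)=\mathrm{Hom}(\mathfrak{g},V)\oplus V$, $C^2_{NLA}(\mathfrak{g},V)=\mathrm{Hom}(\mathfrak{g}^{\otimes2},V)\oplus\mathrm{Hom}(\mathfrak{g},V)$, and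 $d^1(f,g)=(\delta^1f,-\partial^0g-\phi^1f)$, where $(\delta^1f)(x,y)=\bar l_V(x,f(y))+\bar r_V(f(x),y)-f([x,y])$, $(\partial^0g)(x)=-\big(\bar r_V(g,Nx)-N_V\bar r_V(g,x)+\bar r_V(N_Vg,x)\big)$, $\phi^1(f)=f\circ N-N_V\circ f$. $H^2_{NLA}(\mathfrak{g},V)$ is the space of $2$-cocycles modulo $B^2_{NLA}=\mathrm{im}\,d^1$; two elements are in the same cohomology class when they differ by an element of $B^2_{NLA}$. *)

theory Defs
  imports Complex_Main "HOL-Library.Function_Algebras" "HOL-Library.Product_Plus"
begin

text \<open>
  A vector space over a field 'k of characteristic 0 is a type with a scalar multiplication
  satisfying the library locale \<^locale>\<open>vector_space\<close>. An element of Hom(A \<otimes> B, C) is represented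
  by the corresponding bilinear map A \<times> B \<rightarrow> C in curried form.
\<close>

definition bilinear_map ::
  "('k::field \<Rightarrow> 'a::ab_group_add \<Rightarrow> 'a) \<Rightarrow> ('k \<Rightarrow> 'b::ab_group_add \<Rightarrow> 'b)
    \<Rightarrow> ('k \<Rightarrow> 'c::ab_group_add \<Rightarrow> 'c) \<Rightarrow> ('a \<Rightarrow> 'b \<Rightarrow> 'c) \<Rightarrow> bool" where
  "bilinear_map sA sB sC \<beta> \<longleftrightarrow>
     (\<forall>a. Vector_Spaces.linear sB sC (\<lambda>b. \<beta> a b)) \<and>
     (\<forall>b. Vector_Spaces.linear sA sC (\<lambda>a. \<beta> a b))"

locale leibniz_algebra = vector_space scale
  for scale :: "'k::field_char_0 \<Rightarrow> 'a::ab_group_add \<Rightarrow> 'a" +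
  fixes br :: "'a \<Rightarrow> 'a \<Rightarrow> 'a"
  assumes bilinear_bracket: "bilinear_map scale scale scale br"
    and left_leibniz: "br x (br y z) = br (br x y) z + br y (br x z)"

locale nijenhuis_leibniz_algebra = leibniz_algebra scale br
  for scale :: "'k::field_char_0 \<Rightarrow> 'a::ab_group_add \<Rightarrow> 'a" and br +
  fixes N :: "'a \<Rightarrow> 'a"
  assumes linear_N: "Vector_Spaces.linear scale scale N"
    and nijenhuis: "br (N x) (N y) = N (br (N x) y + br x (N y) - N (br x y))"

definition nla_morphism ::
  "('k::field \<Rightarrow> 'a::ab_group_add \<Rightarrow> 'a) \<Rightarrow> ('a \<Rightarrow> 'a \<Rightarrow> 'a) \<Rightarrow> ('a \<Rightarrow> 'a)
    \<Rightarrow> ('k \<Rightarrow> 'b::ab_group_add \<Rightarrow> 'b) \<Rightarrow> ('b \<Rightarrow> 'b \<Rightarrow> 'b) \<Rightarrow> ('b \<Rightarrow> 'b)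
    \<Rightarrow> ('a \<Rightarrow> 'b) \<Rightarrow> bool" where
  "nla_morphism sA brA NA sB brB NB h \<longleftrightarrow>
     Vector_Spaces.linear sA sB h \<and>
     (\<forall>x y. h (brA x y) = brB (h x) (h y)) \<and>
     (\<forall>x. h (NA x) = NB (h x))"

locale abelian_extension =
  G: nijenhuis_leibniz_algebra sG br N +
  V: nijenhuis_leibniz_algebra sV "\<lambda>_ _. 0" NV +
  E: nijenhuis_leibniz_algebra sE brE NE
  for sG :: "'k::field_char_0 \<Rightarrow> 'g::ab_group_add \<Rightarrow> 'g" and br and N
    and sV :: "'k \<Rightarrow> 'v::ab_group_add \<Rightarrow> 'v" and NV
    and sE :: "'k \<Rightarrow> 'e::ab_group_add \<Rightarrow> 'e" and brE and NE +
  fixes i :: "'v \<Rightarrow> 'e" and p :: "'e \<Rightarrow> 'g"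
  assumes morphism_i: "nla_morphism sV (\<lambda>_ _. 0) NV sE brE NE i"
    and morphism_p: "nla_morphism sE brE NE sG br N p"
    and inj_i: "inj i"
    and exact_middle: "range i = {e. p e = 0}"
    and surj_p: "surj p"

definition is_section ::
  "('k::field \<Rightarrow> 'g::ab_group_add \<Rightarrow> 'g) \<Rightarrow> ('k \<Rightarrow> 'e::ab_group_add \<Rightarrow> 'e)
    \<Rightarrow> ('e \<Rightarrow> 'g) \<Rightarrow> ('g \<Rightarrow> 'e) \<Rightarrow> bool" where
  "is_section sG sE p s \<longleftrightarrow> Vector_Spaces.linear sG sE s \<and> p \<circ> s = id"

text \<open>
  The identification of V with i(V) is made explicit: wherever an element of i(V) is regarded as
  an element of V, it is pulled back along the injective map i by \<^term>\<open>inv i\<close>. That the elements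
  concerned do lie in i(V) is shown below.
\<close>

definition induced_left ::
  "('e \<Rightarrow> 'e \<Rightarrow> 'e) \<Rightarrow> ('v \<Rightarrow> 'e) \<Rightarrow> ('g \<Rightarrow> 'e) \<Rightarrow> 'g \<Rightarrow> 'v \<Rightarrow> 'v" where
  "induced_left brE i s x u = inv i (brE (s x) (i u))"

definition induced_right ::
  "('e \<Rightarrow> 'e \<Rightarrow> 'e) \<Rightarrow> ('v \<Rightarrow> 'e) \<Rightarrow> ('g \<Rightarrow> 'e) \<Rightarrow> 'v \<Rightarrow> 'g \<Rightarrow> 'v" where
  "induced_right brE i s u x = inv i (brE (i u) (s x))"

definition ext_psi ::
  "('g \<Rightarrow> 'g \<Rightarrow> 'g) \<Rightarrow> ('e::ab_group_add \<Rightarrow> 'e \<Rightarrow> 'e) \<Rightarrow> ('v \<Rightarrow> 'e) \<Rightarrow> ('g \<Rightarrow> 'e)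
    \<Rightarrow> 'g \<Rightarrow> 'g \<Rightarrow> 'v" where
  "ext_psi br brE i s = (\<lambda>x y. inv i (brE (s x) (s y) - s (br x y)))"

definition ext_chi ::
  "('g \<Rightarrow> 'g) \<Rightarrow> ('e::ab_group_add \<Rightarrow> 'e) \<Rightarrow> ('v \<Rightarrow> 'e) \<Rightarrow> ('g \<Rightarrow> 'e) \<Rightarrow> 'g \<Rightarrow> 'v" where
  "ext_chi N NE i s = (\<lambda>x. inv i (NE (s x) - s (N x)))"

definition C1_NLA ::
  "('k::field \<Rightarrow> 'g::ab_group_add \<Rightarrow> 'g) \<Rightarrow> ('k \<Rightarrow> 'v::ab_group_add \<Rightarrow> 'v)
    \<Rightarrow> (('g \<Rightarrow> 'v) \<times> 'v) set" where
  "C1_NLA sG sV = {f. Vector_Spaces.linear sG sV f} \<times> UNIV"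

definition C2_NLA ::
  "('k::field \<Rightarrow> 'g::ab_group_add \<Rightarrow> 'g) \<Rightarrow> ('k \<Rightarrow> 'v::ab_group_add \<Rightarrow> 'v)
    \<Rightarrow> (('g \<Rightarrow> 'g \<Rightarrow> 'v) \<times> ('g \<Rightarrow> 'v)) set" where
  "C2_NLA sG sV = {\<psi>. bilinear_map sG sG sV \<psi>} \<times> {\<chi>. Vector_Spaces.linear sG sV \<chi>}"

definition delta1 ::
  "('g \<Rightarrow> 'g \<Rightarrow> 'g) \<Rightarrow> ('g \<Rightarrow> 'v \<Rightarrow> 'v) \<Rightarrow> ('v \<Rightarrow> 'g \<Rightarrow> 'v) \<Rightarrow> ('g \<Rightarrow> 'v)
    \<Rightarrow> 'g \<Rightarrow> 'g \<Rightarrow> 'v::ab_group_add" where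
  "delta1 br l r f = (\<lambda>x y. l x (f y) + r (f x) y - f (br x y))"

definition partial0 ::
  "('g \<Rightarrow> 'g) \<Rightarrow> ('v \<Rightarrow> 'v) \<Rightarrow> ('v \<Rightarrow> 'g \<Rightarrow> 'v) \<Rightarrow> 'v \<Rightarrow> 'g \<Rightarrow> 'v::ab_group_add" where
  "partial0 N NV r g = (\<lambda>x. - (r g (N x) - NV (r g x) + r (NV g) x))"

definition phi1 ::
  "('g \<Rightarrow> 'g) \<Rightarrow> ('v \<Rightarrow> 'v) \<Rightarrow> ('g \<Rightarrow> 'v) \<Rightarrow> 'g \<Rightarrow> 'v::ab_group_add" where
  "phi1 N NV f = (\<lambda>x. f (N x) - NV (f x))"

definition d1_NLA ::
  "('g \<Rightarrow> 'g \<Rightarrow> 'g) \<Rightarrow> ('g \<Rightarrow> 'g) \<Rightarrow> ('v \<Rightarrow> 'v) \<Rightarrow> ('g \<Rightarrow> 'v \<Rightarrow> 'v) \<Rightarrow> ('v \<Rightarrow> 'g \<Rightarrow> 'v)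
    \<Rightarrow> ('g \<Rightarrow> 'v) \<times> 'v \<Rightarrow> ('g \<Rightarrow> 'g \<Rightarrow> 'v) \<times> ('g \<Rightarrow> 'v::ab_group_add)" where
  "d1_NLA br N NV l r = (\<lambda>(f, g). (delta1 br l r f, \<lambda>x. - partial0 N NV r g x - phi1 N NV f x))"

definition B2_NLA ::
  "('k::field \<Rightarrow> 'g::ab_group_add \<Rightarrow> 'g) \<Rightarrow> ('k \<Rightarrow> 'v::ab_group_add \<Rightarrow> 'v)
    \<Rightarrow> ('g \<Rightarrow> 'g \<Rightarrow> 'g) \<Rightarrow> ('g \<Rightarrow> 'g) \<Rightarrow> ('v \<Rightarrow> 'v) \<Rightarrow> ('g \<Rightarrow> 'v \<Rightarrow> 'v) \<Rightarrow> ('v \<Rightarrow> 'g \<Rightarrow> 'v)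
    \<Rightarrow> (('g \<Rightarrow> 'g \<Rightarrow> 'v) \<times> ('g \<Rightarrow> 'v)) set" where
  "B2_NLA sG sV br N NV l r = d1_NLA br N NV l r ` C1_NLA sG sV"

text \<open>
  Two elements are in the same cohomology class when they differ by an element of B2. The classes
  are formed in all of C2; on 2-cocycles this is the relation defining the second cohomology space.
\<close>

definition cohomologous ::
  "('k::field \<Rightarrow> 'g::ab_group_add \<Rightarrow> 'g) \<Rightarrow> ('k \<Rightarrow> 'v::ab_group_add \<Rightarrow> 'v)
    \<Rightarrow> ('g \<Rightarrow> 'g \<Rightarrow> 'g) \<Rightarrow> ('g \<Rightarrow> 'g) \<Rightarrow> ('v \<Rightarrow> 'v) \<Rightarrow> ('g \<Rightarrow> 'v \<Rightarrow> 'v) \<Rightarrow> ('v \<Rightarrow> 'g \<Rightarrow> 'v)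
    \<Rightarrow> (('g \<Rightarrow> 'g \<Rightarrow> 'v) \<times> ('g \<Rightarrow> 'v)) rel" where
  "cohomologous sG sV br N NV l r =
     {(c, c'). c \<in> C2_NLA sG sV \<and> c' \<in> C2_NLA sG sV \<and> c - c' \<in> B2_NLA sG sV br N NV l r}"

definition cohomology_class ::
  "('k::field \<Rightarrow> 'g::ab_group_add \<Rightarrow> 'g) \<Rightarrow> ('k \<Rightarrow> 'v::ab_group_add \<Rightarrow> 'v)
    \<Rightarrow> ('g \<Rightarrow> 'g \<Rightarrow> 'g) \<Rightarrow> ('g \<Rightarrow> 'g) \<Rightarrow> ('v \<Rightarrow> 'v) \<Rightarrow> ('g \<Rightarrow> 'v \<Rightarrow> 'v) \<Rightarrow> ('v \<Rightarrow> 'g \<Rightarrow> 'v)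
    \<Rightarrow> ('g \<Rightarrow> 'g \<Rightarrow> 'v) \<times> ('g \<Rightarrow> 'v) \<Rightarrow> (('g \<Rightarrow> 'g \<Rightarrow> 'v) \<times> ('g \<Rightarrow> 'v)) set" where
  "cohomology_class sG sV br N NV l r c = cohomologous sG sV br N NV l r `` {c}"

context abelian_extension
begin

lemma i_inv: "p e = 0 \<Longrightarrow> i (inv i e) = e"
  using exact_middle by (intro f_inv_into_f) auto

lemma p_i: "p (i u) = 0"
  using exact_middle by auto

lemma p_bracket: "p (brE a b) = br (p a) (p b)"
  using morphism_p by (simp add: nla_morphism_def)

lemma p_N: "p (NE a) = N (p a)"
  using morphism_p by (simp add: nla_morphism_def)

lemma p_diff: "p (a - b) = p a - p b"
proof -
  interpret p: Vector_Spaces.linear sE sG p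
    using morphism_p by (simp add: nla_morphism_def)
  show ?thesis by (rule p.diff)
qed

lemma br_0_right: "br x 0 = 0"
proof -
  interpret b: Vector_Spaces.linear sG sG "br x"
    using G.bilinear_bracket by (simp add: bilinear_map_def)
  show ?thesis by (rule b.zero)
qed

lemma br_0_left: "br 0 x = 0"
proof -
  interpret b: Vector_Spaces.linear sG sG "\<lambda>y. br y x"
    using G.bilinear_bracket by (simp add: bilinear_map_def)
  show ?thesis by (rule b.zero)
qed

lemma section_p: "is_section sG sE p s \<Longrightarrow> p (s x) = x"
  by (simp add: is_section_def fun_eq_iff)

lemma i_induced_left: "i (induced_left brE i s x u) = brE (s x) (i u)"
  by (simp add: induced_left_def i_inv p_bracket p_i br_0_right)

lemma i_induced_right: "i (induced_right brE i s u x) = brE (i u) (s x)"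
  by (simp add: induced_right_def i_inv p_bracket p_i br_0_left)

lemma i_ext_psi:
  "is_section sG sE p s \<Longrightarrow> i (ext_psi br brE i s x y) = brE (s x) (s y) - s (br x y)"
  by (simp add: ext_psi_def i_inv p_bracket p_diff section_p)

lemma i_ext_chi:
  "is_section sG sE p s \<Longrightarrow> i (ext_chi N NE i s x) = NE (s x) - s (N x)"
  by (simp add: ext_chi_def i_inv p_N p_diff section_p)

lemma i_0: "i 0 = 0"
proof -
  interpret i: Vector_Spaces.linear sV sE i
    using morphism_i by (simp add: nla_morphism_def)
  show ?thesis by (rule i.zero)
qed

lemma linear_into_V:
  assumes "Vector_Spaces.linear sA sE (\<lambda>x. i (f x))"
  shows "Vector_Spaces.linear sA sV f"
proof -
  interpret h: Vector_Spaces.linear sA sE "\<lambda>x. i (f x)" by (rule assms)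
  interpret i: Vector_Spaces.linear sV sE i
    using morphism_i by (simp add: nla_morphism_def)
  show ?thesis
  proof unfold_locales
    show "f (x + y) = f x + f y" for x y
      using h.add[of x y] by (intro injD[OF inj_i]) (simp add: i.add)
    show "f (sA c x) = sV c (f x)" for c x
      using h.scale[of c x] by (intro injD[OF inj_i]) (simp add: i.scale)
  qed
qed

lemma ext_cochain_in_C2:
  assumes s: "is_section sG sE p s"
  shows "(ext_psi br brE i s, ext_chi N NE i s) \<in> C2_NLA sG sV"
proof -
  interpret s: Vector_Spaces.linear sG sE s
    using s by (simp add: is_section_def)
  interpret N: Vector_Spaces.linear sG sG N by (rule G.linear_N)
  interpret NE: Vector_Spaces.linear sE sE NE by (rule E.linear_N)
  have chi: "Vector_Spaces.linear sG sV (ext_chi N NE i s)"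
  proof (rule linear_into_V)
    show "Vector_Spaces.linear sG sE (\<lambda>x. i (ext_chi N NE i s x))"
      by unfold_locales
        (simp_all add: i_ext_chi[OF s] s.add N.add NE.add s.scale N.scale NE.scale
          E.scale_right_diff_distrib)
  qed
  have psi1: "Vector_Spaces.linear sG sV (ext_psi br brE i s x)" for x
  proof (rule linear_into_V)
    interpret b: Vector_Spaces.linear sG sG "br x"
      using G.bilinear_bracket by (simp add: bilinear_map_def)
    interpret bE: Vector_Spaces.linear sE sE "brE (s x)"
      using E.bilinear_bracket by (simp add: bilinear_map_def)
    show "Vector_Spaces.linear sG sE (\<lambda>y. i (ext_psi br brE i s x y))"
      by unfold_locales
        (simp_all add: i_ext_psi[OF s] s.add b.add bE.add s.scale b.scale bE.scale
          E.scale_right_diff_distrib)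
  qed
  have psi2: "Vector_Spaces.linear sG sV (\<lambda>x. ext_psi br brE i s x y)" for y
  proof (rule linear_into_V)
    interpret b: Vector_Spaces.linear sG sG "\<lambda>x. br x y"
      using G.bilinear_bracket by (simp add: bilinear_map_def)
    interpret bE: Vector_Spaces.linear sE sE "\<lambda>x. brE x (s y)"
      using E.bilinear_bracket by (simp add: bilinear_map_def)
    show "Vector_Spaces.linear sG sE (\<lambda>x. i (ext_psi br brE i s x y))"
      by unfold_locales
        (simp_all add: i_ext_psi[OF s] s.add b.add bE.add s.scale b.scale bE.scale
          E.scale_right_diff_distrib)
  qed
  show ?thesis
    using chi psi1 psi2 by (simp add: C2_NLA_def bilinear_map_def)
qed

text \<open>The induced representation does not depend on the section.\<close>

lemma induced_left_unique:
  assumes s: "is_section sG sE p s" and s': "is_section sG sE p s'"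
  shows "induced_left brE i s = induced_left brE i s'"
proof (intro ext)
  fix x u
  interpret bE: Vector_Spaces.linear sE sE "\<lambda>a. brE a (i u)"
    using E.bilinear_bracket by (simp add: bilinear_map_def)
  obtain v where v: "s x - s' x = i v"
    using exact_middle s s' by (force simp: p_diff section_p)
  have "brE (i v) (i u) = 0"
    using morphism_i i_0 unfolding nla_morphism_def by metis
  then show "induced_left brE i s x u = induced_left brE i s' x u"
    using bE.diff[of "s x" "s' x"] v by (simp add: induced_left_def)
qed

lemma induced_right_unique:
  assumes s: "is_section sG sE p s" and s': "is_section sG sE p s'"
  shows "induced_right brE i s = induced_right brE i s'"
proof (intro ext)
  fix u x
  interpret bE: Vector_Spaces.linear sE sE "brE (i u)"
    using E.bilinear_bracket by (simp add: bilinear_map_def)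
  obtain v where v: "s x - s' x = i v"
    using exact_middle s s' by (force simp: p_diff section_p)
  have "brE (i u) (i v) = 0"
    using morphism_i i_0 unfolding nla_morphism_def by metis
  then show "induced_right brE i s u x = induced_right brE i s' u x"
    using bE.diff[of "s x" "s' x"] v by (simp add: induced_right_def)
qed

end

end

theory Submission
  imports Defs
begin

text \<open>
  Two sections \<open>s1\<close>, \<open>s2\<close> of \<open>p\<close> differ by a linear map into the kernel of \<open>p\<close>, that is, by
  \<open>i \<circ> f\<close> for a linear \<open>f : \<gg> \<rightarrow> V\<close> (the map \<open>section_diff\<close> below). The pair \<open>(f, 0)\<close>
  is the cochain whose coboundary is \<open>(\<psi>1, \<chi>1) - (\<psi>2, \<chi>2)\<close>. For the brackets this is the expansion
  \<open>[s1 x, s1 y] - [s2 x, s2 y] = [s1 x, i (f y)] + [i (f x), s2 y]\<close>, which holds without a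
  term quadratic in \<open>f\<close> because one factor is taken from each section; the two terms on the right are
  the left and the right action, which may be computed with different sections since the induced
  representation does not depend on the section. For the operators,
  \<open>\<chi>1 - \<chi>2 = N\<^sub>V \<circ> f - f \<circ> N = - \<phi>\<^sup>1 f\<close> because \<open>i\<close> intertwines \<open>N\<^sub>V\<close> with the operator of
  the extension; the component in \<open>V\<close> of the cochain may be taken to be \<open>0\<close> because \<open>\<partial>\<^sup>0 0 = 0\<close>. All
  these equations are checked in the extension, after applying the injective map \<open>i\<close>.

  Equality of the cohomology classes as sets then needs that being cohomologous is an equivalence
  relation, which holds because the image of \<open>d\<^sup>1\<close> is a subgroup: \<open>d\<^sup>1\<close> is additive, as the induced
  actions are additive in \<open>V\<close>.
\<close>

context abelian_extension
begin

section \<open>The image of the differential is a subgroup\<close>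

lemma i_diff: "i (u - v) = i u - i v"
proof -
  interpret i: Vector_Spaces.linear sV sE i
    using morphism_i by (simp add: nla_morphism_def)
  show ?thesis by (rule i.diff)
qed

lemma i_add: "i (u + v) = i u + i v"
proof -
  interpret i: Vector_Spaces.linear sV sE i
    using morphism_i by (simp add: nla_morphism_def)
  show ?thesis by (rule i.add)
qed

lemma i_N: "i (NV u) = NE (i u)"
  using morphism_i by (simp add: nla_morphism_def)

lemma brE_diff_left: "brE (a - b) c = brE a c - brE b c"
proof -
  interpret b: Vector_Spaces.linear sE sE "\<lambda>a. brE a c"
    using E.bilinear_bracket by (simp add: bilinear_map_def)
  show ?thesis by (rule b.diff)
qed

lemma brE_diff_right: "brE c (a - b) = brE c a - brE c b"
proof -
  interpret b: Vector_Spaces.linear sE sE "brE c"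
    using E.bilinear_bracket by (simp add: bilinear_map_def)
  show ?thesis by (rule b.diff)
qed

lemma NE_diff: "NE (a - b) = NE a - NE b"
proof -
  interpret N: Vector_Spaces.linear sE sE NE by (rule E.linear_N)
  show ?thesis by (rule N.diff)
qed

lemma NV_diff: "NV (u - v) = NV u - NV v"
proof -
  interpret N: Vector_Spaces.linear sV sV NV by (rule V.linear_N)
  show ?thesis by (rule N.diff)
qed

lemma induced_left_diff:
  "induced_left brE i s x (u - v) = induced_left brE i s x u - induced_left brE i s x v"
  by (intro injD[OF inj_i]) (simp add: i_induced_left i_diff brE_diff_right)

lemma induced_right_diff:
  "induced_right brE i s (u - v) x = induced_right brE i s u x - induced_right brE i s v x"
  by (intro injD[OF inj_i]) (simp add: i_induced_right i_diff brE_diff_left)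

lemma d1_NLA_diff:
  fixes s :: "'g \<Rightarrow> 'e"
  defines "l \<equiv> induced_left brE i s" and "r \<equiv> induced_right brE i s"
  shows "d1_NLA br N NV l r (c - c') = d1_NLA br N NV l r c - d1_NLA br N NV l r c'"
  by (cases c; cases c')
    (simp add: d1_NLA_def delta1_def partial0_def phi1_def fun_eq_iff l_def r_def
      induced_left_diff induced_right_diff NV_diff)

lemma C1_NLA_diff:
  assumes "c \<in> C1_NLA sG sV" "c' \<in> C1_NLA sG sV"
  shows "c - c' \<in> C1_NLA sG sV"
proof -
  interpret GV: vector_space_pair sG sV ..
  show ?thesis
    using assms GV.linear_compose_sub[of "fst c" "fst c'"]
    by (cases c; cases c') (simp add: C1_NLA_def fun_diff_def)
qed

lemma zero_in_C1_NLA: "0 \<in> C1_NLA sG sV"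
proof -
  interpret GV: vector_space_pair sG sV ..
  show ?thesis
    using GV.linear_zero by (simp add: C1_NLA_def zero_prod_def zero_fun_def)
qed

lemma B2_NLA_diff:
  fixes s :: "'g \<Rightarrow> 'e"
  defines "B \<equiv> B2_NLA sG sV br N NV (induced_left brE i s) (induced_right brE i s)"
  assumes "b \<in> B" "b' \<in> B"
  shows "b - b' \<in> B"
proof -
  obtain c c' where c: "c \<in> C1_NLA sG sV" "c' \<in> C1_NLA sG sV"
    and b: "b = d1_NLA br N NV (induced_left brE i s) (induced_right brE i s) c"
      "b' = d1_NLA br N NV (induced_left brE i s) (induced_right brE i s) c'"
    using assms(2,3) unfolding B_def B2_NLA_def by blast
  show ?thesis
    unfolding B_def B2_NLA_def b d1_NLA_diff[symmetric]
    by (intro imageI C1_NLA_diff c)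
qed

lemma zero_in_B2_NLA:
  fixes s :: "'g \<Rightarrow> 'e"
  shows "0 \<in> B2_NLA sG sV br N NV (induced_left brE i s) (induced_right brE i s)"
proof -
  have "d1_NLA br N NV (induced_left brE i s) (induced_right brE i s) 0
      \<in> B2_NLA sG sV br N NV (induced_left brE i s) (induced_right brE i s)"
    unfolding B2_NLA_def by (intro imageI zero_in_C1_NLA)
  from B2_NLA_diff[OF this this] show ?thesis by simp
qed

lemma equiv_cohomologous:
  fixes s :: "'g \<Rightarrow> 'e"
  shows "equiv (C2_NLA sG sV)
    (cohomologous sG sV br N NV (induced_left brE i s) (induced_right brE i s))"
proof -
  let ?B = "B2_NLA sG sV br N NV (induced_left brE i s) (induced_right brE i s)"
  have sym: "c' - c \<in> ?B" if "c - c' \<in> ?B" for c c'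
    using B2_NLA_diff[OF zero_in_B2_NLA that] by simp
  have trans: "c - c'' \<in> ?B" if "c - c' \<in> ?B" "c' - c'' \<in> ?B" for c c' c''
    using B2_NLA_diff[OF that(1) sym[OF that(2)]] by simp
  show ?thesis
    unfolding cohomologous_def
    by (intro equivI refl_onI symI transI) (auto simp: zero_in_B2_NLA intro: sym trans)
qed


section \<open>The difference of two sections\<close>

definition section_diff :: "('g \<Rightarrow> 'e) \<Rightarrow> ('g \<Rightarrow> 'e) \<Rightarrow> 'g \<Rightarrow> 'v" where
  "section_diff s s' x = inv i (s x - s' x)"

lemma i_section_diff:
  assumes "is_section sG sE p s" "is_section sG sE p s'"
  shows "i (section_diff s s' x) = s x - s' x"
  using assms by (simp add: section_diff_def i_inv p_diff section_p)

lemma linear_section_diff: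
  assumes "is_section sG sE p s" "is_section sG sE p s'"
  shows "Vector_Spaces.linear sG sV (section_diff s s')"
proof (rule linear_into_V)
  interpret GE: vector_space_pair sG sE ..
  show "Vector_Spaces.linear sG sE (\<lambda>x. i (section_diff s s' x))"
    using assms GE.linear_compose_sub[of s s']
    by (simp add: i_section_diff is_section_def)
qed

text \<open>
  The left action is taken with the first section and the right action with the second: with this
  choice the two terms of the product rule give the difference of the brackets exactly.
\<close>

lemma ext_psi_diff:
  assumes s: "is_section sG sE p s" and s': "is_section sG sE p s'"
  shows "ext_psi br brE i s - ext_psi br brE i s' =
    delta1 br (induced_left brE i s) (induced_right brE i s') (section_diff s s')"
proof (intro ext injD[OF inj_i])
  fix x y
  show "i ((ext_psi br brE i s - ext_psi br brE i s') x y) =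
      i (delta1 br (induced_left brE i s) (induced_right brE i s') (section_diff s s') x y)"
    by (simp add: delta1_def i_diff i_add i_ext_psi[OF s] i_ext_psi[OF s'] i_induced_left
        i_induced_right i_section_diff[OF s s'] brE_diff_left brE_diff_right)
qed

lemma ext_chi_diff:
  assumes s: "is_section sG sE p s" and s': "is_section sG sE p s'"
  shows "ext_chi N NE i s - ext_chi N NE i s' = - phi1 N NV (section_diff s s')"
proof (intro ext injD[OF inj_i])
  fix x
  show "i ((ext_chi N NE i s - ext_chi N NE i s') x) =
      i ((- phi1 N NV (section_diff s s')) x)"
    by (simp add: phi1_def i_diff i_N i_ext_chi[OF s] i_ext_chi[OF s']
        i_section_diff[OF s s'] NE_diff)
qed

lemma partial0_zero: "partial0 N NV (induced_right brE i s) 0 = 0"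
  using induced_right_diff[of s 0 0] NV_diff[of 0 0] by (simp add: partial0_def fun_eq_iff)

lemma ext_cochain_diff:
  assumes s: "is_section sG sE p s"
    and s1: "is_section sG sE p s1" and s2: "is_section sG sE p s2"
  shows "(ext_psi br brE i s1, ext_chi N NE i s1) - (ext_psi br brE i s2, ext_chi N NE i s2) =
    d1_NLA br N NV (induced_left brE i s) (induced_right brE i s) (section_diff s1 s2, 0)"
  using ext_psi_diff[OF s1 s2] ext_chi_diff[OF s1 s2]
  by (simp add: d1_NLA_def partial0_zero fun_eq_iff induced_left_unique[OF s s1]
      induced_right_unique[OF s s2])

end


section \<open>Independence of the section\<close>

theorem proposition6p6:
  fixes sG :: "'k::field_char_0 \<Rightarrow> 'g::ab_group_add \<Rightarrow> 'g"
    and br :: "'g \<Rightarrow> 'g \<Rightarrow> 'g" and N :: "'g \<Rightarrow> 'g"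
    and sV :: "'k \<Rightarrow> 'v::ab_group_add \<Rightarrow> 'v" and NV :: "'v \<Rightarrow> 'v"
    and sE :: "'k \<Rightarrow> 'e::ab_group_add \<Rightarrow> 'e"
    and brE :: "'e \<Rightarrow> 'e \<Rightarrow> 'e" and NE :: "'e \<Rightarrow> 'e"
    and i :: "'v \<Rightarrow> 'e" and p :: "'e \<Rightarrow> 'g"
    and s s1 s2 :: "'g \<Rightarrow> 'e"
    and l :: "'g \<Rightarrow> 'v \<Rightarrow> 'v" and r :: "'v \<Rightarrow> 'g \<Rightarrow> 'v"
    and \<psi>1 \<psi>2 :: "'g \<Rightarrow> 'g \<Rightarrow> 'v" and \<chi>1 \<chi>2 :: "'g \<Rightarrow> 'v"
  assumes "abelian_extension sG br N sV NV sE brE NE i p"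
    and "is_section sG sE p s"
    and "l = induced_left brE i s" and "r = induced_right brE i s"
    and "is_section sG sE p s1"
    and "\<psi>1 = ext_psi br brE i s1" and "\<chi>1 = ext_chi N NE i s1"
    and "is_section sG sE p s2"
    and "\<psi>2 = ext_psi br brE i s2" and "\<chi>2 = ext_chi N NE i s2"
  shows "cohomology_class sG sV br N NV l r (\<psi>1, \<chi>1) = cohomology_class sG sV br N NV l r (\<psi>2, \<chi>2)
    \<and> (\<psi>1, \<chi>1) - (\<psi>2, \<chi>2) \<in> d1_NLA br N NV l r ` C1_NLA sG sV"
proof -
  interpret abelian_extension sG br N sV NV sE brE NE i p by (rule assms(1))
  have mem: "(section_diff s1 s2, 0) \<in> C1_NLA sG sV"
    using linear_section_diff[OF assms(5,8)] by (simp add: C1_NLA_def)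
  have B: "(\<psi>1, \<chi>1) - (\<psi>2, \<chi>2) \<in> d1_NLA br N NV l r ` C1_NLA sG sV"
    unfolding assms(3,4,6,7,9,10) ext_cochain_diff[OF assms(2,5,8)]
    by (rule imageI[OF mem])
  then have "((\<psi>1, \<chi>1), (\<psi>2, \<chi>2)) \<in> cohomologous sG sV br N NV l r"
    using ext_cochain_in_C2[OF assms(5)] ext_cochain_in_C2[OF assms(8)]
    by (simp add: cohomologous_def B2_NLA_def assms(6,7,9,10))
  then have "cohomology_class sG sV br N NV l r (\<psi>1, \<chi>1)
      = cohomology_class sG sV br N NV l r (\<psi>2, \<chi>2)"
    unfolding cohomology_class_def assms(3,4)
    by (rule equiv_class_eq[OF equiv_cohomologous])
  with B show ?thesis by blast
qed

end
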